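(* Let $A \in \mathbb{C}^{m \times n}$, $B \in \mathbb{C}^{p \times q}$ and $C \in \mathbb{C}^{m \times q}$, and let $X_0 \in \mathbb{C}^{n \times p}$ be any particular solution of the matrix equation $AXB = C$ (that is, $A X_0 B = C$). Then for any choice of $\{1\}$-inverses $A^{(1)}$ of $A$ and $B^{(1)}$ of $B$, the general solution of the matrix equation $AXB = C$ is given by the formula $$X = g(Y) = X_0 + Y - A^{(1)} A Y B B^{(1)},$$ where $Y \in \mathbb{C}^{n \times p}$ is arbitrary; that is, $\{X \in \mathbb{C}^{n\times p} : AXB = C\} = \{g(Y) : Y \in \mathbb{C}^{n \times p}\}$. Moreover, this general solution is reproductive (that is, $g \circ g = g$ as a map $\mathbb{C}^{n\times p} \to \mathbb{C}^{n \times p}$) if and only if $X_0 = A^{(1)} C B^{(1)}$.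
   Context: For a matrix $M \in \mathbb{C}^{m \times n}$, a $\{1\}$-inverse of $M$ is any matrix $M^{(1)} \in \mathbb{C}^{n \times m}$ satisfying $M M^{(1)} M = M$. A formula $X = g(Y)$ for the general solution of an equation, where $g : S \to S$, is called reproductive if $g$ satisfies the condition of reproductivity $g \circ g = g$; here $S = \mathbb{C}^{n \times p}$. *)

theory Defs
  imports "HOL-Analysis.Analysis"
begin

text \<open>The type \<open>complex ^ 'n ^ 'm\<close> consists of the complex matrices with
  rows indexed by \<open>'m\<close> and columns indexed by \<open>'n\<close>.\<close>

definition one_inverse :: "complex ^ 'n ^ 'm \<Rightarrow> complex ^ 'm ^ 'n \<Rightarrow> bool" where
  "one_inverse M N \<longleftrightarrow> M ** N ** M = M"

definition reproductive :: "('s \<Rightarrow> 's) \<Rightarrow> bool" where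
  "reproductive g \<longleftrightarrow> g \<circ> g = g"

definition solution_formula ::
  "complex ^ 'n ^ 'm \<Rightarrow> complex ^ 'q ^ 'p \<Rightarrow> complex ^ 'm ^ 'n \<Rightarrow> complex ^ 'p ^ 'q \<Rightarrow>
   complex ^ 'p ^ 'n \<Rightarrow> complex ^ 'p ^ 'n \<Rightarrow> complex ^ 'p ^ 'n" where
  "solution_formula A B A1 B1 X0 Y = X0 + Y - A1 ** A ** Y ** B ** B1"

end

theory Submission
  imports Defs
begin

text \<open>Write \<open>g\<close> for the solution formula. Every value \<open>g Y\<close> solves the equation, because
  \<open>A ** A1 ** A = A\<close> and \<open>B ** B1 ** B = B\<close>; conversely \<open>X = g (X - X0)\<close> for a solution \<open>X\<close>.
  Since \<open>g Y\<close> is a solution, \<open>g (g Y) = g Y + (X0 - A1 ** C ** B1)\<close>.\<close>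

lemma matrix_add_rdistrib: "(A + B) ** C = A ** C + B ** C"
  by (vector matrix_matrix_mult_def sum.distrib[symmetric] distrib_right)

lemma matrix_diff_ldistrib:
  fixes A :: "'a::ring_1 ^ 'n ^ 'm"
  shows "A ** (B - C) = A ** B - A ** C"
  by (vector matrix_matrix_mult_def sum_subtractf[symmetric] right_diff_distrib)

lemma matrix_diff_rdistrib:
  fixes C :: "'a::ring_1 ^ 'n ^ 'm"
  shows "(A - B) ** C = A ** C - B ** C"
  by (vector matrix_matrix_mult_def sum_subtractf[symmetric] left_diff_distrib)

text \<open>In this grouping the subtracted term depends on \<open>Y\<close> only through
  \<open>A ** Y ** B\<close>, so a known value of that product can be substituted directly.\<close>

lemma solution_formula_assoc:
  "solution_formula A B A1 B1 X0 Y = X0 + Y - A1 ** (A ** Y ** B) ** B1"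
  by (simp add: solution_formula_def matrix_mul_assoc)

lemma solution_formula_solves:
  assumes "A ** X0 ** B = C" "one_inverse A A1" "one_inverse B B1"
  shows "A ** solution_formula A B A1 B1 X0 Y ** B = C"
proof -
  have "A ** (A1 ** A ** Y ** B ** B1) ** B = (A ** A1 ** A) ** Y ** (B ** B1 ** B)"
    by (simp add: matrix_mul_assoc)
  also have "\<dots> = A ** Y ** B"
    using assms(2,3) by (simp add: one_inverse_def)
  \<comment> \<open>By linearity the contributions of \<open>Y\<close> and of the subtracted term
    cancel, leaving \<open>A ** X0 ** B\<close>.\<close>
  finally show ?thesis
    using assms(1)
    by (simp add: solution_formula_def matrix_add_ldistrib matrix_diff_ldistrib
        matrix_add_rdistrib matrix_diff_rdistrib)
qed

text \<open>The difference of two solutions solves the homogeneous equation, so the subtracted term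
  vanishes at \<open>X - X0\<close>.\<close>

lemma solution_formula_diff:
  assumes "A ** X0 ** B = C" "A ** X ** B = C"
  shows "solution_formula A B A1 B1 X0 (X - X0) = X"
proof -
  have "A ** (X - X0) ** B = 0"
    using assms by (simp add: matrix_diff_ldistrib matrix_diff_rdistrib)
  then show ?thesis
    by (simp add: solution_formula_assoc)
qed

theorem theorem3:
  fixes A :: "complex ^ 'n ^ 'm" and B :: "complex ^ 'q ^ 'p" and C :: "complex ^ 'q ^ 'm"
    and X0 :: "complex ^ 'p ^ 'n"
    and A1 :: "complex ^ 'm ^ 'n" and B1 :: "complex ^ 'p ^ 'q"
  assumes "A ** X0 ** B = C"
    and "one_inverse A A1"
    and "one_inverse B B1"
  shows "{X :: complex ^ 'p ^ 'n. A ** X ** B = C} = range (solution_formula A B A1 B1 X0) \<and>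
    (reproductive (solution_formula A B A1 B1 X0) \<longleftrightarrow> X0 = A1 ** C ** B1)"
proof
  let ?g = "solution_formula A B A1 B1 X0"
  have solves: "A ** ?g Y ** B = C" for Y
    using assms by (rule solution_formula_solves)
  show "{X. A ** X ** B = C} = range ?g"
    using solves solution_formula_diff[OF assms(1), symmetric] by blast
  have "?g (?g Y) = X0 + ?g Y - A1 ** C ** B1" for Y
    using solution_formula_assoc[of A B A1 B1 X0 "?g Y"] solves by simp
  \<comment> \<open>The shift from \<open>?g Y\<close> to \<open>?g (?g Y)\<close> is the same for
    every \<open>Y\<close>, so idempotence amounts to this one constant being zero.\<close>
  then show "reproductive ?g \<longleftrightarrow> X0 = A1 ** C ** B1"
    by (simp add: reproductive_def fun_eq_iff diff_eq_eq add.commute)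
qed

end
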